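(* Every commutative quaternion can be represented by a $2\times 2$ complex matrix.
   Context: The commutative quaternions are the elements of the set $H=\{q=t+ix+jy+kz : t,x,y,z\in\mathbb{R},\ i,j,k\notin\mathbb{R}\}$, with commutative multiplication determined by the rules $i^2=k^2=-1$, $j^2=1$, $ijk=-1$, $ij=ji=k$, $jk=kj=i$, $ki=ik=-j$ for the basis elements $i,j,k$. *)

theory Defs
  imports "HOL-Analysis.Analysis"
begin

text \<open>The commutative quaternion \<open>t + i x + j y + k z\<close> is \<open>CQuat t x y z\<close>.\<close>

datatype cquat = CQuat (cq_t: real) (cq_x: real) (cq_y: real) (cq_z: real)

instantiation cquat :: "{comm_ring_1, real_algebra_1}"
begin

definition "0 = CQuat 0 0 0 0"
definition "1 = CQuat 1 0 0 0"
definition "p + q = CQuat (cq_t p + cq_t q) (cq_x p + cq_x q) (cq_y p + cq_y q) (cq_z p + cq_z q)"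
definition "p - q = CQuat (cq_t p - cq_t q) (cq_x p - cq_x q) (cq_y p - cq_y q) (cq_z p - cq_z q)"
definition "- q = CQuat (- cq_t q) (- cq_x q) (- cq_y q) (- cq_z q)"
definition "scaleR r q = CQuat (r * cq_t q) (r * cq_x q) (r * cq_y q) (r * cq_z q)"

text \<open>The bilinear extension of the rules \<open>cq_basis_rules\<close> proved below.\<close>
definition "p * q = CQuat
  (cq_t p * cq_t q - cq_x p * cq_x q + cq_y p * cq_y q - cq_z p * cq_z q)
  (cq_t p * cq_x q + cq_x p * cq_t q + cq_y p * cq_z q + cq_z p * cq_y q)
  (cq_t p * cq_y q + cq_y p * cq_t q - cq_x p * cq_z q - cq_z p * cq_x q)
  (cq_t p * cq_z q + cq_z p * cq_t q + cq_x p * cq_y q + cq_y p * cq_x q)"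

instance
  by standard
    (simp_all add: zero_cquat_def one_cquat_def plus_cquat_def minus_cquat_def uminus_cquat_def
       scaleR_cquat_def times_cquat_def algebra_simps)

end

definition cq_i :: cquat where "cq_i = CQuat 0 1 0 0"
definition cq_j :: cquat where "cq_j = CQuat 0 0 1 0"
definition cq_k :: cquat where "cq_k = CQuat 0 0 0 1"

lemma cq_basis_rules:
  "cq_i * cq_i = - 1" "cq_k * cq_k = - 1" "cq_j * cq_j = 1" "cq_i * cq_j * cq_k = - 1"
  "cq_i * cq_j = cq_k" "cq_j * cq_i = cq_k" "cq_j * cq_k = cq_i" "cq_k * cq_j = cq_i"
  "cq_k * cq_i = - cq_j" "cq_i * cq_k = - cq_j"
  by (simp_all add: cq_i_def cq_j_def cq_k_def one_cquat_def uminus_cquat_def times_cquat_def)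

lemma CQuat_eq:
  "CQuat t x y z = of_real t + cq_i * of_real x + cq_j * of_real y + cq_k * of_real z"
  by (simp add: of_real_def cq_i_def cq_j_def cq_k_def one_cquat_def plus_cquat_def
       scaleR_cquat_def times_cquat_def)

text \<open>The complex numbers as the subring of all \<open>t + i x\<close>; this is what makes the commutative
  quaternions a complex algebra, of dimension 2 with basis \<open>1, j\<close>.\<close>

definition cq_of_complex :: "complex \<Rightarrow> cquat" where
  "cq_of_complex c = of_real (Re c) + cq_i * of_real (Im c)"

end

theory Submission imports Defs begin

text \<open>
  Since \<open>i j = k\<close>, the quaternion \<open>t + i x + j y + k z\<close> is \<open>a + b j\<close> with the complex
  coefficients \<open>a = t + i x\<close> and \<open>b = y + i z\<close>. So the commutative quaternions form a free module
  of rank 2 over the subring of complex numbers, with basis \<open>1, j\<close>, and multiplication by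
  \<open>a + b j\<close> is linear over that subring, because the ring is commutative. As \<open>j\<^sup>2 = 1\<close>, it sends
  \<open>1\<close> to \<open>a + b j\<close> and \<open>j\<close> to \<open>b + a j\<close>: its matrix has \<open>a\<close> on the diagonal and \<open>b\<close> off it.
  This regular representation is a ring homomorphism, a complex number \<open>c\<close> (the case \<open>a = c\<close>,
  \<open>b = 0\<close>) acts as a scalar, and the representation is faithful because the image of \<open>1\<close> already
  determines \<open>a\<close> and \<open>b\<close>.
\<close>

definition cq_coeff_1 :: "cquat \<Rightarrow> complex" where
  "cq_coeff_1 q = Complex (cq_t q) (cq_x q)"

definition cq_coeff_j :: "cquat \<Rightarrow> complex" where
  "cq_coeff_j q = Complex (cq_y q) (cq_z q)"

definition cq_matrix :: "cquat \<Rightarrow> complex ^ 2 ^ 2" where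
  "cq_matrix q = (\<chi> r s. if r = s then cq_coeff_1 q else cq_coeff_j q)"

lemma cq_coeff_add:
  "cq_coeff_1 (p + q) = cq_coeff_1 p + cq_coeff_1 q"
  "cq_coeff_j (p + q) = cq_coeff_j p + cq_coeff_j q"
  by (simp_all add: cq_coeff_1_def cq_coeff_j_def plus_cquat_def complex_eq_iff)

text \<open>The expansion of \<open>(a + b j) (c + d j)\<close> with \<open>j\<^sup>2 = 1\<close>; it is what makes \<open>cq_matrix\<close>
  multiplicative.\<close>

lemma cq_coeff_mult:
  "cq_coeff_1 (p * q) = cq_coeff_1 p * cq_coeff_1 q + cq_coeff_j p * cq_coeff_j q"
  "cq_coeff_j (p * q) = cq_coeff_1 p * cq_coeff_j q + cq_coeff_j p * cq_coeff_1 q"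
  by (simp_all add: cq_coeff_1_def cq_coeff_j_def times_cquat_def complex_eq_iff)

lemma cq_coeff_of_complex:
  "cq_coeff_1 (cq_of_complex c) = c" "cq_coeff_j (cq_of_complex c) = 0"
proof -
  have "cq_of_complex c = CQuat (Re c) (Im c) 0 0"
    using CQuat_eq[of "Re c" "Im c" 0 0] by (simp add: cq_of_complex_def)
  then show "cq_coeff_1 (cq_of_complex c) = c" "cq_coeff_j (cq_of_complex c) = 0"
    by (simp_all add: cq_coeff_1_def cq_coeff_j_def complex_eq_iff)
qed

lemma cq_matrix_add: "cq_matrix (p + q) = cq_matrix p + cq_matrix q"
  by (simp add: cq_matrix_def vec_eq_iff cq_coeff_add)

lemma cq_matrix_mult: "cq_matrix (p * q) = cq_matrix p ** cq_matrix q"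
  by (simp add: cq_matrix_def matrix_matrix_mult_def vec_eq_iff forall_2 sum_2 cq_coeff_mult
      add.commute)

lemma cq_matrix_of_complex: "cq_matrix (cq_of_complex c) = mat c"
  by (simp add: cq_matrix_def mat_def vec_eq_iff cq_coeff_of_complex)

lemma inj_cq_matrix: "inj cq_matrix"
proof (rule injI)
  fix p q assume "cq_matrix p = cq_matrix q"
  then have "cq_coeff_1 p = cq_coeff_1 q" "cq_coeff_j p = cq_coeff_j q"
    by (simp_all add: cq_matrix_def vec_eq_iff forall_2)
  then show "p = q"
    by (simp add: cq_coeff_1_def cq_coeff_j_def cquat.expand)
qed

theorem theorem3p2:
  "\<exists>f :: cquat \<Rightarrow> complex ^ 2 ^ 2.
     inj f \<and>
     (\<forall>p q. f (p + q) = f p + f q) \<and>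
     (\<forall>p q. f (p * q) = f p ** f q) \<and>
     (\<forall>c. f (cq_of_complex c) = mat c)"
  using inj_cq_matrix cq_matrix_add cq_matrix_mult cq_matrix_of_complex by blast

end
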